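(* Let $\{e_\alpha;e^*_\alpha\}_{\alpha\in\Gamma}$ be a biorthogonal system in a normed space $X$. Then the normed space $Y=\operatorname{span}\{e_\alpha\}_{\alpha\in\Gamma}$ (with the norm inherited from $X$) admits a locally finite tiling by bounded convex bodies.
   Context: All normed spaces are real. A biorthogonal system in a normed space $X$ is a family $\{e_\alpha;e_\alpha^*\}_{\alpha\in\Gamma}\subseteq X\times X^*$ (with $\Gamma$ an arbitrary index set) such that $e^*_\alpha(e_\beta)=\delta_{\alpha,\beta}$ for all $\alpha,\beta\in\Gamma$. The span is the algebraic linear span (no closure). A convex body is a closed convex set with non-empty interior. A tiling of $Y$ is a collection of convex bodies in $Y$ that cover $Y$ and have mutually disjoint interiors. A tiling is locally finite if each point has a neighbourhood that intersects only finitely many elements of the tiling. *)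

theory Defs
  imports "HOL-Analysis.Analysis"
begin

definition biorthogonal_system ::
    "'i set \<Rightarrow> ('i \<Rightarrow> 'a::real_normed_vector) \<Rightarrow> ('i \<Rightarrow> 'a \<Rightarrow>\<^sub>L real) \<Rightarrow> bool"
  where "biorthogonal_system \<Gamma> e e' \<longleftrightarrow>
    (\<forall>\<alpha>\<in>\<Gamma>. \<forall>\<beta>\<in>\<Gamma>. blinfun_apply (e' \<alpha>) (e \<beta>) = (if \<alpha> = \<beta> then 1 else 0))"

(* In the following two definitions Y is a linear subspace of the ambient normed space, viewed as
   a normed space in its own right: closedness and interiors are relative to Y, which in general
   is neither closed nor of non-empty interior in the ambient space. *)

definition convex_body_in :: "'a::real_normed_vector set \<Rightarrow> 'a set \<Rightarrow> bool"
  where "convex_body_in Y C \<longleftrightarrow>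
    closedin (top_of_set Y) C \<and> convex C \<and> top_of_set Y interior_of C \<noteq> {}"

definition tiling_of :: "'a::real_normed_vector set \<Rightarrow> 'a set set \<Rightarrow> bool"
  where "tiling_of Y \<T> \<longleftrightarrow>
    (\<forall>C\<in>\<T>. convex_body_in Y C) \<and> \<Union>\<T> = Y \<and>
    pairwise (\<lambda>C D. disjnt (top_of_set Y interior_of C) (top_of_set Y interior_of D)) \<T>"

end

theory Submission
  imports Defs
begin

text \<open>
  The tiling comes from a continuous, piecewise affine, coercive function on \<open>Y\<close>. Suppose a
  family \<open>H\<close> of continuous affine functionals satisfies \<open>sup H \<ge> norm\<close> on
  \<open>Y\<close> and is such that near every point only finitely many members compete for the maximum. The
  sets on which a given \<open>h \<in> H\<close> is maximal and takes values between \<open>k\<close> and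
  \<open>k + 1\<close> are then closed, convex, bounded and locally finite, they cover \<open>Y\<close>, and
  distinct ones have disjoint interiors because affine functionals that agree on an open set agree
  everywhere (\<open>tiling_from_affine_maximum\<close>).

  To find \<open>H\<close>, rescale the coordinate functionals to \<open>c \<alpha>\<close> of norm one.
  Every vector of \<open>Y\<close> has finitely many nonzero coordinates. Consider \<open>\<Phi> = norm +
  \<Psi>\<close>, where \<open>\<Psi> z\<close> is the supremum of \<open>\<Sum>i. (c (\<alpha>\<^sub>i)
  z)\<^sup>2 / 2 ^ i\<close> over finite sequences of distinct indices. At a vector \<open>g\<close> with
  support \<open>G\<close> the supremum is attained at an enumeration of \<open>G\<close>, so the tangent of
  the corresponding quadratic form, together with a functional norming \<open>g\<close>, is an affine
  minorant of \<open>\<Phi>\<close> touching it at \<open>g\<close>. It lies below \<open>\<Phi>\<close> by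
  at least \<open>(c \<alpha> z - c \<alpha> g)\<^sup>2 / 2 ^ card G\<close> for each \<open>\<alpha> \<in>
  G\<close> (\<open>exposing_functional\<close>). The tangent at \<open>g\<close> is thus far below
  \<open>\<Phi>\<close> at every vector that has a vanishing coordinate in \<open>G\<close>.

  The vectors with support exactly \<open>G\<close> are exhausted by compact sets \<open>K G n\<close> on
  which the coordinates in \<open>G\<close> are at least \<open>1/(n+1)\<close> in absolute value. Raise the
  tangents at points of \<open>K G n\<close> by a tiny amount depending on \<open>G\<close> and
  \<open>n\<close>, and by compactness keep finitely many such that at every point of \<open>K G n\<close>
  one of them exceeds \<open>\<Phi>\<close> (\<open>finite_cover_by_slices\<close>). The maximum of all of
  them exceeds \<open>\<Phi>\<close>, hence the norm. Near a point \<open>y\<close> a member exceeds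
  \<open>\<Phi>\<close> by some fixed margin, which rules out all but finitely many \<open>n\<close>; and a
  raised tangent with \<open>G\<close> not contained in the support of \<open>y\<close> does not
  exceed \<open>\<Phi>\<close> near \<open>y\<close>, which leaves finitely many \<open>G\<close>
  (\<open>locally_finite_affine_family\<close>).
\<close>

section \<open>Norming functionals\<close>

text \<open>The inequality \<open>p (t x) \<le> t p x\<close> for all \<open>t > 0\<close> already yields equality, by applying it to
  \<open>1/t\<close>; stating only the inequality halves the work of checking sublinearity.\<close>

definition sublinear :: "('a::real_vector \<Rightarrow> real) \<Rightarrow> bool"
  where "sublinear p \<longleftrightarrow>
    (\<forall>x y. p (x + y) \<le> p x + p y) \<and> (\<forall>t>0. \<forall>x. p (t *\<^sub>R x) \<le> t * p x)"

lemma sublinear_add: "sublinear p \<Longrightarrow> p (x + y) \<le> p x + p y"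
  by (simp add: sublinear_def)

lemma sublinear_scaleR:
  assumes "sublinear p" "t > 0"
  shows "p (t *\<^sub>R x) = t * p x"
proof (rule antisym)
  show "p (t *\<^sub>R x) \<le> t * p x"
    using assms by (simp add: sublinear_def)
  have "p ((1/t) *\<^sub>R t *\<^sub>R x) \<le> (1/t) * p (t *\<^sub>R x)"
    using assms unfolding sublinear_def by (meson divide_pos_pos zero_less_one)
  then show "t * p x \<le> p (t *\<^sub>R x)"
    using assms(2) by (simp add: field_simps)
qed

lemma sublinear_zero: "sublinear p \<Longrightarrow> p 0 = 0"
  using sublinear_scaleR[of p 2 0] by simp

lemma sublinear_minus: "sublinear p \<Longrightarrow> - p (- x) \<le> p x"
  using sublinear_add[of p x "- x"] sublinear_zero[of p] by simp

text \<open>The largest sublinear function below \<open>p\<close> whose value at \<open>- u\<close> is at most \<open>- p u\<close>, that is,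
  which is linear on the line through \<open>u\<close> and agrees with \<open>p\<close> at \<open>u\<close>. It serves twice: a
  minimal sublinear function admits no proper reduction and is therefore odd, and reducing
  the norm along \<open>g\<close> before minimising forces the linear minorant to norm \<open>g\<close>.\<close>

definition reduce_along :: "('a::real_vector \<Rightarrow> real) \<Rightarrow> 'a \<Rightarrow> 'a \<Rightarrow> real"
  where "reduce_along p u x = (INF t\<in>{0..}. p (x + t *\<^sub>R u) - t * p u)"

context
  fixes p :: "'a::real_vector \<Rightarrow> real" and u :: 'a
  assumes p: "sublinear p"
begin

lemma reduce_along_bdd_below: "bdd_below ((\<lambda>t. p (x + t *\<^sub>R u) - t * p u) ` {0..})"
proof (rule bdd_belowI2)
  fix t :: real assume "t \<in> {0..}"
  then have "p (t *\<^sub>R u) = t * p u"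
    using sublinear_scaleR[OF p, of t u] sublinear_zero[OF p] by (cases "t = 0") auto
  then show "- p (- x) \<le> p (x + t *\<^sub>R u) - t * p u"
    using sublinear_add[OF p, of "- x" "x + t *\<^sub>R u"] by simp
qed

lemma reduce_along_le: "t \<ge> 0 \<Longrightarrow> reduce_along p u x \<le> p (x + t *\<^sub>R u) - t * p u"
  unfolding reduce_along_def by (rule cINF_lower[OF reduce_along_bdd_below]) simp

lemma reduce_along_greatest:
  "(\<And>t. t \<ge> 0 \<Longrightarrow> c \<le> p (x + t *\<^sub>R u) - t * p u) \<Longrightarrow> c \<le> reduce_along p u x"
  unfolding reduce_along_def by (rule cINF_greatest) auto

lemma reduce_along_le_self: "reduce_along p u x \<le> p x"
  using reduce_along_le[of 0 x] by simp

lemma reduce_along_minus: "reduce_along p u (- u) \<le> - p u"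
  using reduce_along_le[of 1 "- u"] sublinear_zero[OF p] by simp

lemma sublinear_reduce_along: "sublinear (reduce_along p u)"
  unfolding sublinear_def
proof (intro conjI allI impI)
  fix x y
  have "reduce_along p u (x + y) - (p (y + s *\<^sub>R u) - s * p u) \<le> p (x + t *\<^sub>R u) - t * p u"
    if "t \<ge> 0" "s \<ge> 0" for t s
    using reduce_along_le[of "t + s" "x + y"] that
      sublinear_add[OF p, of "x + t *\<^sub>R u" "y + s *\<^sub>R u"]
    by (simp add: algebra_simps)
  then have "reduce_along p u (x + y) - (p (y + s *\<^sub>R u) - s * p u) \<le> reduce_along p u x"
    if "s \<ge> 0" for s
    using that by (intro reduce_along_greatest)
  then have "reduce_along p u (x + y) - reduce_along p u x \<le> reduce_along p u y"
    by (intro reduce_along_greatest) (simp add: algebra_simps)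
  then show "reduce_along p u (x + y) \<le> reduce_along p u x + reduce_along p u y"
    by simp
next
  fix t :: real and x assume t: "t > 0"
  have "(1/t) * reduce_along p u (t *\<^sub>R x) \<le> p (x + s *\<^sub>R u) - s * p u" if "s \<ge> 0" for s
  proof -
    have "reduce_along p u (t *\<^sub>R x) \<le> p (t *\<^sub>R (x + s *\<^sub>R u)) - (t * s) * p u"
      using reduce_along_le[of "t * s" "t *\<^sub>R x"] t that by (simp add: algebra_simps)
    also have "\<dots> = t * (p (x + s *\<^sub>R u) - s * p u)"
      unfolding sublinear_scaleR[OF p t] by (simp add: algebra_simps)
    finally show ?thesis
      using t by (simp add: field_simps)
  qed
  then have "(1/t) * reduce_along p u (t *\<^sub>R x) \<le> reduce_along p u x"
    by (rule reduce_along_greatest)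
  then show "reduce_along p u (t *\<^sub>R x) \<le> t * reduce_along p u x"
    using t by (simp add: field_simps)
qed

end

text \<open>Subadditivity passes to the pointwise infimum only because the family is a chain: two members
  evaluated at different points can be replaced by the smaller of the two. The infimum is
  finite because every member lies above \<open>- p (- x)\<close>.\<close>

lemma sublinear_Inf_chain:
  fixes C :: "('a::real_vector \<Rightarrow> real) set"
  assumes C: "C \<noteq> {}" "\<And>q. q \<in> C \<Longrightarrow> sublinear q"
    and chain: "\<And>q r. q \<in> C \<Longrightarrow> r \<in> C \<Longrightarrow> q \<le> r \<or> r \<le> q"
    and below: "\<And>q. q \<in> C \<Longrightarrow> q \<le> p"
  shows "sublinear (\<lambda>x. INF q\<in>C. q x)" "\<And>q x. q \<in> C \<Longrightarrow> (INF q\<in>C. q x) \<le> q x"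
proof -
  have bdd: "bdd_below ((\<lambda>q. q x) ` C)" for x
  proof (rule bdd_belowI2)
    fix q assume "q \<in> C"
    then show "- p (- x) \<le> q x"
      using sublinear_minus[OF C(2), of q x] le_funD[OF below, of q "- x"] by simp
  qed
  show low: "(INF q\<in>C. q x) \<le> q x" if "q \<in> C" for q x
    using bdd that by (rule cINF_lower)
  have great: "c \<le> (INF q\<in>C. q x)" if "\<And>q. q \<in> C \<Longrightarrow> c \<le> q x" for c x
    using C(1) that by (rule cINF_greatest)
  show "sublinear (\<lambda>x. INF q\<in>C. q x)"
    unfolding sublinear_def
  proof (intro conjI allI impI)
    fix x y
    have *: "(INF q\<in>C. q (x + y)) \<le> q x + r y" if "q \<in> C" "r \<in> C" for q r
    proof -
      obtain s where s: "s \<in> C" "s \<le> q" "s \<le> r"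
        using chain[OF \<open>q \<in> C\<close> \<open>r \<in> C\<close>] \<open>q \<in> C\<close> \<open>r \<in> C\<close> by blast
      have "(INF q\<in>C. q (x + y)) \<le> s (x + y)" by (rule low[OF s(1)])
      also have "\<dots> \<le> s x + s y" using C(2)[OF s(1)] by (rule sublinear_add)
      also have "\<dots> \<le> q x + r y" using s by (simp add: le_fun_def add_mono)
      finally show ?thesis .
    qed
    have "(INF q\<in>C. q (x + y)) - r y \<le> (INF q\<in>C. q x)" if "r \<in> C" for r
      using *[OF _ that] by (intro great) (simp add: algebra_simps)
    then have "(INF q\<in>C. q (x + y)) - (INF q\<in>C. q x) \<le> (INF q\<in>C. q y)"
      by (intro great) (simp add: algebra_simps)
    then show "(INF q\<in>C. q (x + y)) \<le> (INF q\<in>C. q x) + (INF q\<in>C. q y)"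
      by simp
  next
    fix t :: real and x assume t: "t > 0"
    have "(1/t) * (INF q\<in>C. q (t *\<^sub>R x)) \<le> q x" if "q \<in> C" for q
      using low[OF that, of "t *\<^sub>R x"] sublinear_scaleR[OF C(2)[OF that] t, of x] t
      by (simp add: field_simps)
    then have "(1/t) * (INF q\<in>C. q (t *\<^sub>R x)) \<le> (INF q\<in>C. q x)"
      by (rule great)
    then show "(INF q\<in>C. q (t *\<^sub>R x)) \<le> t * (INF q\<in>C. q x)"
      using t by (simp add: field_simps)
  qed
qed

text \<open>The Hahn--Banach theorem, in the form that a minimal sublinear function is linear: it
  coincides with its reduction along every \<open>x\<close>, hence is odd, and an odd subadditive function is
  additive.\<close>

lemma linear_below_sublinear:
  fixes p :: "'a::real_vector \<Rightarrow> real"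
  assumes p: "sublinear p"
  obtains q where "linear q" "\<And>x. q x \<le> p x"
proof -
  define A where "A = {q. sublinear q \<and> q \<le> p}"
  have "\<exists>q\<in>A. \<forall>r\<in>A. r \<le> q \<longrightarrow> r = q"
  proof (rule predicate_Zorn[of A "\<lambda>q r. r \<le> q"])
    show "partial_order_on A (relation_of (\<lambda>q r. r \<le> q) A)"
      by (rule partial_order_on_relation_ofI) auto
    fix C assume C: "C \<in> Chains (relation_of (\<lambda>q r. r \<le> q) A)"
    then have CA: "C \<subseteq> A" and chain: "\<And>q r. q \<in> C \<Longrightarrow> r \<in> C \<Longrightarrow> q \<le> r \<or> r \<le> q"
      by (auto simp: Chains_def relation_of_def)
    show "\<exists>u\<in>A. \<forall>a\<in>C. u \<le> a"
    proof (cases "C = {}")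
      case True
      then show ?thesis using p by (auto simp: A_def)
    next
      case False
      have mem: "sublinear q" "q \<le> p" if "q \<in> C" for q
        using CA that by (auto simp: A_def)
      have "sublinear (\<lambda>x. INF q\<in>C. q x)"
        by (rule sublinear_Inf_chain(1)[OF False mem(1) chain mem(2)])
      moreover have low: "(INF q\<in>C. q x) \<le> q x" if "q \<in> C" for q x
        by (rule sublinear_Inf_chain(2)[OF False mem(1) chain mem(2) that])
      moreover have "(\<lambda>x. INF q\<in>C. q x) \<le> p"
      proof -
        obtain q where "q \<in> C" using False by blast
        then show ?thesis
          using low mem(2) unfolding le_fun_def by (meson order_trans)
      qed
      ultimately show ?thesis
        using low by (intro bexI[of _ "\<lambda>x. INF q\<in>C. q x"]) (auto simp: A_def le_fun_def)
    qed
  qed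
  then obtain q where q: "sublinear q" "q \<le> p"
    and min_A: "\<And>r. r \<in> A \<Longrightarrow> r \<le> q \<Longrightarrow> r = q"
    by (auto simp: A_def)
  have min: "r = q" if "sublinear r" "r \<le> q" for r
    using min_A[of r] that q(2) by (auto simp: A_def)
  have odd: "q (- x) = - q x" for x
  proof (rule antisym)
    have "reduce_along q x = q"
      using q(1) by (intro min sublinear_reduce_along) (auto simp: le_fun_def reduce_along_le_self)
    then show "q (- x) \<le> - q x"
      using reduce_along_minus[OF q(1), of x] by simp
    show "- q x \<le> q (- x)"
      using sublinear_minus[OF q(1), of x] by simp
  qed
  have "linear q"
  proof (rule linearI)
    fix x y
    show "q (x + y) = q x + q y"
      using sublinear_add[OF q(1), of x y] sublinear_add[OF q(1), of "- x" "- y"]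
        odd[of x] odd[of y] odd[of "x + y"] by simp
  next
    fix t :: real and x
    consider "t > 0" | "t = 0" | "t < 0" by linarith
    then show "q (t *\<^sub>R x) = t *\<^sub>R q x"
    proof cases
      case 3
      then show ?thesis
        using sublinear_scaleR[OF q(1), of "- t" x] odd[of "t *\<^sub>R x"] by simp
    qed (auto simp: sublinear_scaleR[OF q(1)] sublinear_zero[OF q(1)])
  qed
  with q(2) show ?thesis
    by (intro that[of q]) (auto simp: le_fun_def)
qed

lemma norming_functional:
  fixes g :: "'a::real_normed_vector"
  obtains \<nu> where "bounded_linear \<nu>" "\<And>x. \<nu> x \<le> norm x" "\<nu> g = norm g"
proof -
  have n: "sublinear (norm :: 'a \<Rightarrow> real)"
    by (simp add: sublinear_def norm_triangle_ineq)
  obtain \<nu> where \<nu>: "linear \<nu>" "\<And>x. \<nu> x \<le> reduce_along norm g x"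
    using linear_below_sublinear[OF sublinear_reduce_along[OF n]] by blast
  have le: "\<nu> x \<le> norm x" for x
    using \<nu>(2)[of x] reduce_along_le_self[OF n, of g x] by linarith
  have "norm (\<nu> x) \<le> norm x * 1" for x
    using le[of x] le[of "- x"] linear_neg[OF \<nu>(1), of x] by (simp add: abs_le_iff)
  then have "bounded_linear \<nu>"
    using linear_add[OF \<nu>(1)] linear_scale[OF \<nu>(1)] by (intro bounded_linear_intro[of _ 1]) simp_all
  moreover have "\<nu> g = norm g"
    using \<nu>(2)[of "- g"] reduce_along_minus[OF n, of g] le[of g] linear_neg[OF \<nu>(1), of g] by simp
  ultimately show ?thesis
    using that le by blast
qed

section \<open>Tilings from locally finite maxima of affine functionals\<close>

definition affine_functional :: "('a::real_normed_vector \<Rightarrow> real) \<Rightarrow> bool"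
  where "affine_functional h \<longleftrightarrow> (\<exists>L b. bounded_linear L \<and> h = (\<lambda>x. L x + b))"

lemma affine_functional_continuous:
  assumes "affine_functional h"
  shows "continuous_on S h"
proof -
  obtain L b where L: "bounded_linear L" "h = (\<lambda>x. L x + b)"
    using assms by (auto simp: affine_functional_def)
  show ?thesis
    unfolding L(2) by (intro continuous_intros linear_continuous_on L(1))
qed

lemma affine_functional_combination:
  assumes "affine_functional h"
  shows "h ((1 - t) *\<^sub>R x + t *\<^sub>R y) = (1 - t) * h x + t * h y"
proof -
  obtain L b where L: "bounded_linear L" "h = (\<lambda>x. L x + b)"
    using assms by (auto simp: affine_functional_def)
  interpret bounded_linear L by fact
  show ?thesis
    by (simp add: L(2) add diff scaleR algebra_simps)
qed

lemma affine_functional_lincomb: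
  assumes "affine_functional h" "affine_functional h'"
  shows "affine_functional (\<lambda>x. r * h x + s * h' x)"
proof -
  obtain L b where L: "bounded_linear L" "h = (\<lambda>x. L x + b)"
    using assms by (auto simp: affine_functional_def)
  obtain L' b' where L': "bounded_linear L'" "h' = (\<lambda>x. L' x + b')"
    using assms by (auto simp: affine_functional_def)
  have "bounded_linear (\<lambda>x. r * L x + s * L' x)"
    using L(1) L'(1) by (intro bounded_linear_add bounded_linear_const_mult)
  moreover have "(\<lambda>x. r * h x + s * h' x) = (\<lambda>x. (r * L x + s * L' x) + (r * b + s * b'))"
    by (simp add: L(2) L'(2) algebra_simps)
  ultimately show ?thesis
    unfolding affine_functional_def by blast
qed

lemma affine_functional_diff:
  "affine_functional h \<Longrightarrow> affine_functional h' \<Longrightarrow> affine_functional (\<lambda>x. h x - h' x)"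
  using affine_functional_lincomb[of h h' 1 "- 1"] by simp

lemma affine_functional_add:
  "affine_functional h \<Longrightarrow> affine_functional h' \<Longrightarrow> affine_functional (\<lambda>x. h x + h' x)"
  using affine_functional_lincomb[of h h' 1 1] by simp

lemma affine_functional_const: "affine_functional (\<lambda>x. b)"
  unfolding affine_functional_def
  by (rule exI[of _ "\<lambda>x. 0"], rule exI[of _ b]) simp

lemma affine_functional_linear: "bounded_linear L \<Longrightarrow> affine_functional L"
  unfolding affine_functional_def by (rule exI[of _ L], rule exI[of _ 0]) simp

lemma convex_affine_le:
  assumes "affine_functional h" "affine_functional h'"
  shows "convex {x. h x \<le> h' x}"
  unfolding convex_alt
  by (auto simp: affine_functional_combination assms intro!: add_mono mult_left_mono)

text \<open>Relative interiors are all that is available in a subspace \<open>Y\<close>, so the identity principle for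
  affine functions is needed relative to \<open>Y\<close>: a short segment from a point of \<open>V\<close> towards \<open>y\<close>
  stays in \<open>V\<close>.\<close>

lemma affine_functional_zero_on_open:
  assumes h: "affine_functional h" and Y: "convex Y"
    and V: "openin (top_of_set Y) V" "V \<noteq> {}" "\<And>x. x \<in> V \<Longrightarrow> h x = 0"
    and y: "y \<in> Y"
  shows "h y = 0"
proof -
  obtain z where z: "z \<in> V" using V by blast
  obtain U where U: "open U" "V = Y \<inter> U" using V(1) by (auto simp: openin_open)
  define \<gamma> where "\<gamma> t = (1 - t) *\<^sub>R z + t *\<^sub>R y" for t :: real
  have "isCont \<gamma> 0" unfolding \<gamma>_def by (intro continuous_intros)
  moreover have "\<gamma> 0 \<in> U" using z U by (simp add: \<gamma>_def)
  ultimately have "eventually (\<lambda>t. \<gamma> t \<in> U) (at 0)"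
    using U(1) topological_tendstoD by (fastforce simp: isCont_def)
  then obtain d where d: "d > 0" "\<And>t. t \<noteq> 0 \<Longrightarrow> \<bar>t\<bar> < d \<Longrightarrow> \<gamma> t \<in> U"
    by (auto simp: eventually_at dist_real_def)
  define t where "t = min 1 (d / 2)"
  have t: "0 < t" "t \<le> 1" "\<bar>t\<bar> < d" using d(1) by (auto simp: t_def)
  have "\<gamma> t \<in> Y"
    using Y z U y t by (auto simp: \<gamma>_def convex_alt)
  then have "\<gamma> t \<in> V" using d(2)[of t] t U by auto
  then have "h (\<gamma> t) = 0" by (rule V(3))
  then have "(1 - t) * h z + t * h y = 0"
    unfolding \<gamma>_def affine_functional_combination[OF h] .
  then show ?thesis using V(3)[OF z] t by simp
qed

text \<open>A finite union of closed sets without interior has no interior, so near each point the thin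
  members of a locally finite closed cover can be discarded.\<close>

lemma locally_finite_closed_fat_cover:
  assumes cover: "topspace X \<subseteq> \<Union>\<C>"
    and closed: "\<And>C. C \<in> \<C> \<Longrightarrow> closedin X C"
    and fin: "locally_finite_in X \<C>"
  shows "topspace X \<subseteq> \<Union>{C \<in> \<C>. X interior_of C \<noteq> {}}"
proof
  fix y assume y: "y \<in> topspace X"
  obtain V where V: "openin X V" "y \<in> V" "finite {C \<in> \<C>. C \<inter> V \<noteq> {}}"
    using fin y by (auto simp: locally_finite_in_def)
  define F where "F = {C \<in> \<C>. C \<inter> V \<noteq> {} \<and> X interior_of C \<noteq> {}}"
  define N where "N = {C \<in> \<C>. C \<inter> V \<noteq> {} \<and> X interior_of C = {}}"
  have finF: "finite F" "finite N"
    by (rule finite_subset[OF _ V(3)], auto simp: F_def N_def)+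
  have thin: "finite M \<Longrightarrow> M \<subseteq> N \<Longrightarrow> X interior_of (\<Union>M) = {}" for M
  proof (induction M rule: finite_induct)
    case (insert C M)
    then have "closedin X C" "X interior_of C = {}" by (auto simp: N_def closed)
    then show ?case
      using insert interior_of_union_eq_empty[of X C "\<Union>M"] by simp
  qed simp
  show "y \<in> \<Union>{C \<in> \<C>. X interior_of C \<noteq> {}}"
  proof (rule ccontr)
    assume no: "y \<notin> \<Union>{C \<in> \<C>. X interior_of C \<noteq> {}}"
    have "openin X (V - \<Union>F)"
      using V(1) finF(1) by (intro openin_diff closedin_Union) (auto simp: F_def closed)
    moreover have "V - \<Union>F \<subseteq> \<Union>N"
    proof
      fix z assume z: "z \<in> V - \<Union>F"
      then have "z \<in> topspace X" using V(1) openin_subset by blast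
      then obtain C where "C \<in> \<C>" "z \<in> C" using cover by blast
      with z show "z \<in> \<Union>N" by (auto simp: F_def N_def)
    qed
    ultimately have "V - \<Union>F \<subseteq> X interior_of (\<Union>N)"
      by (simp add: interior_of_maximal)
    moreover have "y \<in> V - \<Union>F" using V(2) no by (auto simp: F_def)
    ultimately show False using thin[OF finF(2) order_refl] by blast
  qed
qed

lemma locally_finite_in_subset:
  "locally_finite_in X \<C> \<Longrightarrow> \<D> \<subseteq> \<C> \<Longrightarrow> locally_finite_in X \<D>"
  unfolding locally_finite_in_def
proof (elim conjE, intro conjI ballI)
  assume \<D>: "\<D> \<subseteq> \<C>" and "\<Union>\<C> \<subseteq> topspace X"
  then show "\<Union>\<D> \<subseteq> topspace X" by blast
  fix x assume "x \<in> topspace X"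
    and "\<forall>x\<in>topspace X. \<exists>V. openin X V \<and> x \<in> V \<and> finite {U \<in> \<C>. U \<inter> V \<noteq> {}}"
  then obtain V where V: "openin X V" "x \<in> V" "finite {U \<in> \<C>. U \<inter> V \<noteq> {}}" by blast
  have "finite {U \<in> \<D>. U \<inter> V \<noteq> {}}"
    by (rule finite_subset[OF _ V(3)]) (use \<D> in blast)
  with V show "\<exists>V. openin X V \<and> x \<in> V \<and> finite {U \<in> \<D>. U \<inter> V \<noteq> {}}" by blast
qed

text \<open>The family need not be locally finite as a family of functions; near each point all but
  finitely many members are strictly below one of the remaining ones, so only finitely many
  compete for the maximum.\<close>

definition locally_finite_max :: "'a::topological_space set \<Rightarrow> ('a \<Rightarrow> real) set \<Rightarrow> bool"
  where "locally_finite_max Y H \<longleftrightarrow> (\<forall>y\<in>Y. \<exists>U F. open U \<and> y \<in> U \<and> finite F \<and> F \<subseteq> H \<and>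
    (\<forall>z\<in>U \<inter> Y. \<exists>h\<in>F. \<forall>h'\<in>H - F. h' z < h z))"

lemma locally_finite_maxD:
  "locally_finite_max Y H \<Longrightarrow> y \<in> Y \<Longrightarrow> \<exists>U F. open U \<and> y \<in> U \<and> finite F \<and> F \<subseteq> H \<and>
    (\<forall>z\<in>U \<inter> Y. \<exists>h\<in>F. \<forall>h'\<in>H - F. h' z < h z)"
  unfolding locally_finite_max_def by (rule bspec)

text \<open>The region where \<open>h\<close> attains the maximum of the family is convex, being cut out by the
  half-spaces \<open>h' \<le> h\<close>, but it may be unbounded. Slicing it along levels of \<open>h\<close>, which on this region
  is the maximum itself, keeps convexity and gives boundedness.\<close>

definition slab_cell ::
    "'a set \<Rightarrow> ('a \<Rightarrow> real) set \<Rightarrow> ('a \<Rightarrow> real) \<Rightarrow> nat \<Rightarrow> 'a set"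
  where "slab_cell Y H h k =
    {y \<in> Y. (\<forall>h'\<in>H. h' y \<le> h y) \<and> real k \<le> h y \<and> h y \<le> real k + 1}"

context
  fixes Y :: "'a::real_normed_vector set" and H :: "('a \<Rightarrow> real) set"
  assumes Y: "convex Y"
    and H: "\<And>h. h \<in> H \<Longrightarrow> affine_functional h"
    and coercive: "\<And>y. y \<in> Y \<Longrightarrow> \<exists>h\<in>H. norm y \<le> h y"
    and locally_finite_max: "locally_finite_max Y H"
begin

lemma slab_cell_eq:
  "slab_cell Y H h k =
    Y \<inter> ((\<Inter>h'\<in>H. {y. h' y \<le> h y}) \<inter> {y. real k \<le> h y} \<inter> {y. h y \<le> real k + 1})"
  by (auto simp: slab_cell_def)

lemma closedin_slab_cell: "h \<in> H \<Longrightarrow> closedin (top_of_set Y) (slab_cell Y H h k)"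
  unfolding slab_cell_eq
  by (intro closedin_closed_Int closed_Int closed_INT ballI closed_Collect_le continuous_intros
      affine_functional_continuous H)

lemma convex_slab_cell: "h \<in> H \<Longrightarrow> convex (slab_cell Y H h k)"
  unfolding slab_cell_eq
  by (intro convex_Int convex_INT Y convex_affine_le affine_functional_const H)

text \<open>Coercivity enters here: on the cell \<open>h\<close> is the maximum of the family, and that maximum is at
  least the norm.\<close>

lemma bounded_slab_cell: "bounded (slab_cell Y H h k)"
  unfolding bounded_iff
proof (intro exI ballI)
  fix y assume y: "y \<in> slab_cell Y H h k"
  then obtain h' where "h' \<in> H" "norm y \<le> h' y" using coercive by (auto simp: slab_cell_def)
  moreover from this(1) have "h' y \<le> h y" "h y \<le> real k + 1" using y by (auto simp: slab_cell_def)
  ultimately show "norm y \<le> real k + 1" by linarith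
qed

lemma slab_cell_cover: "Y \<subseteq> (\<Union>h\<in>H. \<Union>k. slab_cell Y H h k)"
proof
  fix y assume y: "y \<in> Y"
  obtain U F where F: "y \<in> U" "finite F" "F \<subseteq> H" "\<exists>h\<in>F. \<forall>h'\<in>H - F. h' y < h y"
    using locally_finite_maxD[OF locally_finite_max y] y by blast
  obtain h0 where h0: "h0 \<in> F" "\<And>h'. h' \<in> H - F \<Longrightarrow> h' y < h0 y" using F(4) by blast
  then have "Max ((\<lambda>h. h y) ` F) \<in> (\<lambda>h. h y) ` F"
    using F(2) by (intro Max_in) auto
  then obtain h where h: "h \<in> F" "h y = Max ((\<lambda>h. h y) ` F)" by auto
  have max_F: "h' y \<le> h y" if "h' \<in> F" for h'
    unfolding h(2) using F(2) that by (intro Max_ge) auto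
  have max: "h' y \<le> h y" if "h' \<in> H" for h'
    using max_F[of h'] max_F[OF h0(1)] h0(2)[of h'] that by (cases "h' \<in> F") auto
  obtain h' where "h' \<in> H" "norm y \<le> h' y" using coercive[OF y] by blast
  then have "0 \<le> h y" using max[of h'] norm_ge_zero[of y] by linarith
  then have "y \<in> slab_cell Y H h (nat \<lfloor>h y\<rfloor>)"
    using y max by (simp add: slab_cell_def)
  then show "y \<in> (\<Union>h\<in>H. \<Union>k. slab_cell Y H h k)" using h F(3) by blast
qed

lemma locally_finite_slab_cells:
  "locally_finite_in (top_of_set Y) (\<Union>h\<in>H. range (slab_cell Y H h))"
  unfolding locally_finite_in_def
proof (intro conjI ballI)
  show "\<Union> (\<Union>h\<in>H. range (slab_cell Y H h)) \<subseteq> topspace (top_of_set Y)"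
    by (auto simp: slab_cell_def)
  fix y assume "y \<in> topspace (top_of_set Y)"
  then have y: "y \<in> Y" by simp
  obtain U F where F: "open U" "y \<in> U" "finite F" "F \<subseteq> H"
    and dom: "\<And>z. z \<in> U \<inter> Y \<Longrightarrow> \<exists>h\<in>F. \<forall>h'\<in>H - F. h' z < h z"
    using locally_finite_maxD[OF locally_finite_max y] by blast
  define W where "W = U \<inter> (\<Inter>h\<in>F. {z. h z < h y + 1})"
  define K where "K = Max ((\<lambda>h. nat \<lceil>h y + 1\<rceil>) ` F)"
  have W: "open W" "y \<in> W"
  proof -
    have "open {z. h z < h y + 1}" if "h \<in> F" for h
      using that F(4) by (intro open_Collect_less affine_functional_continuous continuous_on_const H) auto
    then show "open W" using F(1,3) by (auto simp: W_def)
    show "y \<in> W" using F(2) by (simp add: W_def)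
  qed
  have "C \<in> (\<Union>h\<in>F. slab_cell Y H h ` {..K})"
    if C: "C \<in> (\<Union>h\<in>H. range (slab_cell Y H h))" "C \<inter> (Y \<inter> W) \<noteq> {}" for C
  proof -
    obtain h k where hk: "h \<in> H" "C = slab_cell Y H h k" using C(1) by blast
    obtain z where z: "z \<in> C" "z \<in> Y" "z \<in> W" using C(2) by blast
    have hF: "h \<in> F"
    proof (rule ccontr)
      assume "h \<notin> F"
      then obtain h' where "h' \<in> F" "h z < h' z" using dom[of z] z hk by (auto simp: W_def)
      moreover have "h' z \<le> h z" using z(1) hk(2) F(4) \<open>h' \<in> F\<close> by (auto simp: slab_cell_def)
      ultimately show False by simp
    qed
    have "real k \<le> h z" using z(1) hk(2) by (simp add: slab_cell_def)
    also have "\<dots> < h y + 1" using z(3) hF by (simp add: W_def)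
    finally have "k \<le> nat \<lceil>h y + 1\<rceil>" by linarith
    also have "\<dots> \<le> K" unfolding K_def using F(3) hF by (intro Max_ge) auto
    finally show ?thesis using hF hk by blast
  qed
  then have "{C \<in> (\<Union>h\<in>H. range (slab_cell Y H h)). C \<inter> (Y \<inter> W) \<noteq> {}}
      \<subseteq> (\<Union>h\<in>F. slab_cell Y H h ` {..K})" by blast
  then have "finite {C \<in> (\<Union>h\<in>H. range (slab_cell Y H h)). C \<inter> (Y \<inter> W) \<noteq> {}}"
    by (rule finite_subset) (simp add: F(3))
  moreover have "openin (top_of_set Y) (Y \<inter> W)" using W(1) by (rule openin_open_Int)
  ultimately show "\<exists>V. openin (top_of_set Y) V \<and> y \<in> V \<and>
      finite {C \<in> (\<Union>h\<in>H. range (slab_cell Y H h)). C \<inter> V \<noteq> {}}"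
    using y W(2) by blast
qed

text \<open>If two interiors meet then \<open>h\<close> and \<open>h'\<close> agree on a relatively open set, hence on \<open>Y\<close>. If moreover
  the levels differ, they are adjacent and the common function equals the shared bounding level
  on an open set, hence is constant on \<open>Y\<close>, and the two cells still coincide as sets.\<close>

lemma slab_cell_eq_of_interiors_meet:
  assumes h: "h \<in> H" "h' \<in> H"
    and meet: "\<not> disjnt (top_of_set Y interior_of slab_cell Y H h k)
                         (top_of_set Y interior_of slab_cell Y H h' k')"
  shows "slab_cell Y H h k = slab_cell Y H h' k'"
proof -
  define V where "V = (top_of_set Y interior_of slab_cell Y H h k) \<inter>
      (top_of_set Y interior_of slab_cell Y H h' k')"
  have V: "openin (top_of_set Y) V" "V \<noteq> {}"
    using meet by (auto simp: V_def disjnt_def)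
  have VC: "V \<subseteq> slab_cell Y H h k" "V \<subseteq> slab_cell Y H h' k'"
    using interior_of_subset[of "top_of_set Y"] by (auto simp: V_def)
  have "h x - h' x = 0" if "x \<in> V" for x
  proof -
    have "h' x \<le> h x" "h x \<le> h' x"
      using VC that h unfolding slab_cell_def by blast+
    then show ?thesis by simp
  qed
  then have eq: "h y = h' y" if "y \<in> Y" for y
    using affine_functional_zero_on_open[OF affine_functional_diff[OF H[OF h(1)] H[OF h(2)]] Y V _ that]
    by auto
  show ?thesis
  proof (cases "k = k'")
    case True
    then show ?thesis using eq by (auto simp: slab_cell_def)
  next
    case False
    have "h x - max (real k) (real k') = 0" if "x \<in> V" for x
    proof -
      have "real k \<le> h x" "h x \<le> real k + 1" "real k' \<le> h x" "h x \<le> real k' + 1"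
        using VC that eq[of x] by (auto simp: slab_cell_def)
      with False show ?thesis by (auto simp: max_def)
    qed
    then have const: "h y = max (real k) (real k')" if "y \<in> Y" for y
      using affine_functional_zero_on_open[OF affine_functional_diff[OF H[OF h(1)]
            affine_functional_const] Y V _ that, of "max (real k) (real k')"] by auto
    obtain x where "x \<in> V" using V by blast
    then have "x \<in> Y" "real k \<le> h x" "h x \<le> real k + 1" "real k' \<le> h x" "h x \<le> real k' + 1"
      using VC eq[of x] by (auto simp: slab_cell_def)
    then show ?thesis
      using const eq by (auto simp: slab_cell_def)
  qed
qed

text \<open>The cells satisfy everything required of a tiling except that some may have empty
  interior; those are dropped without losing the covering property.\<close>

lemma tiling_from_affine_maximum:
  "\<exists>\<T>. tiling_of Y \<T> \<and> locally_finite_in (top_of_set Y) \<T> \<and> (\<forall>C\<in>\<T>. bounded C)"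
proof -
  define \<C> where "\<C> = (\<Union>h\<in>H. range (slab_cell Y H h))"
  define \<T> where "\<T> = {C \<in> \<C>. top_of_set Y interior_of C \<noteq> {}}"
  have lf: "locally_finite_in (top_of_set Y) \<C>"
    unfolding \<C>_def by (rule locally_finite_slab_cells)
  have "Y \<subseteq> \<Union>\<T>"
  proof -
    have "topspace (top_of_set Y) \<subseteq> \<Union>\<C>"
    proof -
      have "\<Union>\<C> = (\<Union>h\<in>H. \<Union>k. slab_cell Y H h k)" by (auto simp: \<C>_def)
      then show ?thesis using slab_cell_cover by simp
    qed
    moreover have "closedin (top_of_set Y) C" if "C \<in> \<C>" for C
      using that closedin_slab_cell by (auto simp: \<C>_def)
    ultimately have "topspace (top_of_set Y) \<subseteq> \<Union>\<T>"
      unfolding \<T>_def by (rule locally_finite_closed_fat_cover[OF _ _ lf])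
    then show ?thesis by simp
  qed
  moreover have "\<Union>\<T> \<subseteq> Y" by (auto simp: \<T>_def \<C>_def slab_cell_def)
  moreover have "convex_body_in Y C" if "C \<in> \<T>" for C
    using that by (auto simp: \<T>_def \<C>_def convex_body_in_def closedin_slab_cell convex_slab_cell)
  moreover have "pairwise (\<lambda>C D. disjnt (top_of_set Y interior_of C) (top_of_set Y interior_of D)) \<T>"
    unfolding pairwise_def \<T>_def \<C>_def using slab_cell_eq_of_interiors_meet by blast
  ultimately have "tiling_of Y \<T>" by (auto simp: tiling_of_def)
  moreover have "locally_finite_in (top_of_set Y) \<T>"
    using lf by (rule locally_finite_in_subset) (auto simp: \<T>_def)
  moreover have "bounded C" if "C \<in> \<T>" for C
    using that bounded_slab_cell by (auto simp: \<T>_def \<C>_def)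
  ultimately show ?thesis by blast
qed

end

section \<open>A function with sharply exposing tangents\<close>

text \<open>\<open>wsum f l\<close> is \<open>\<Sum>i. f (l ! i) / 2 ^ i\<close>.
  The recursive form suits induction over the list.\<close>

primrec wsum :: "('i \<Rightarrow> real) \<Rightarrow> 'i list \<Rightarrow> real"
  where
    "wsum f [] = 0"
  | "wsum f (a # l) = f a + wsum f l / 2"

lemma wsum_abs_le: "(\<And>a. a \<in> set l \<Longrightarrow> \<bar>f a\<bar> \<le> B) \<Longrightarrow> 0 \<le> B \<Longrightarrow> \<bar>wsum f l\<bar> \<le> 2 * B"
proof (induction l)
  case (Cons a l)
  then have "\<bar>f a\<bar> \<le> B" "\<bar>wsum f l\<bar> \<le> 2 * B" by auto
  then show ?case by (auto simp: abs_le_iff)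
qed simp

lemma wsum_diff: "wsum (\<lambda>a. f a - g a) l = wsum f l - wsum g l"
  by (induction l) (auto simp: field_simps)

lemma wsum_nonneg: "(\<And>a. 0 \<le> f a) \<Longrightarrow> 0 \<le> wsum f l"
  by (induction l) auto

lemma wsum_append: "wsum f (l @ [a]) = wsum f l + f a / 2 ^ length l"
  by (induction l) (auto simp: field_simps)

lemma wsum_member:
  assumes "\<And>a. 0 \<le> f a" "a \<in> set l"
  shows "f a / 2 ^ length l \<le> wsum f l"
  using assms(2)
proof (induction l)
  case (Cons b l)
  show ?case
  proof (cases "a = b")
    case True
    have "f b / 2 ^ length (b # l) \<le> f b / 1"
      using assms(1)[of b] by (intro divide_left_mono) (auto simp del: power_Suc)
    then show ?thesis using True wsum_nonneg[of f l] assms(1) by simp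
  next
    case False
    then have "f a / 2 ^ length l \<le> wsum f l" using Cons by simp
    then have "f a / 2 ^ length (b # l) \<le> wsum f l / 2" by simp
    then show ?thesis using assms(1)[of b] by simp
  qed
qed simp

text \<open>Removing a vanishing entry moves the later ones to larger weights.\<close>

lemma wsum_le_filter:
  assumes "\<And>a. 0 \<le> f a"
  shows "wsum f l \<le> wsum f (filter (\<lambda>a. f a \<noteq> 0) l)"
proof (induction l)
  case (Cons a l)
  then show ?case
    using wsum_nonneg[of f l] assms by (cases "f a = 0") auto
qed simp

lemma affine_functional_wsum:
  "(\<And>a. a \<in> set l \<Longrightarrow> affine_functional (h a)) \<Longrightarrow> affine_functional (\<lambda>z. wsum (\<lambda>a. h a z) l)"
proof (induction l)
  case (Cons a l)
  then show ?case
    using affine_functional_lincomb[of "h a" "\<lambda>z. wsum (\<lambda>a. h a z) l" 1 "1/2"] by simp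
qed (simp add: affine_functional_const)

text \<open>With \<open>c\<close> the coordinates on \<open>c\<^sub>0(\<Gamma>)\<close>, this is up to the choice of weights the square of Day's
  norm. Its virtue is that it is a supremum of quadratic forms, each of which lies above its
  tangents by an explicit quadratic amount.\<close>

definition day_square :: "'i set \<Rightarrow> ('i \<Rightarrow> 'a \<Rightarrow> real) \<Rightarrow> 'a \<Rightarrow> real"
  where "day_square \<Gamma> c z = (SUP l\<in>{l. distinct l \<and> set l \<subseteq> \<Gamma>}. wsum (\<lambda>\<alpha>. (c \<alpha> z)\<^sup>2) l)"

context
  fixes \<Gamma> :: "'i set" and c :: "'i \<Rightarrow> 'a::real_normed_vector \<Rightarrow> real"
  assumes linear_c: "\<And>\<alpha>. \<alpha> \<in> \<Gamma> \<Longrightarrow> bounded_linear (c \<alpha>)"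
    and c_le_norm: "\<And>\<alpha> z. \<alpha> \<in> \<Gamma> \<Longrightarrow> \<bar>c \<alpha> z\<bar> \<le> norm z"
begin

lemma c_diff: "\<alpha> \<in> \<Gamma> \<Longrightarrow> c \<alpha> (x - y) = c \<alpha> x - c \<alpha> y"
  using linear_c[of \<alpha>] by (simp add: bounded_linear.linear linear_diff)

lemma day_square_bdd_above:
  "bdd_above ((\<lambda>l. wsum (\<lambda>\<alpha>. (c \<alpha> z)\<^sup>2) l) ` {l. distinct l \<and> set l \<subseteq> \<Gamma>})"
proof (rule bdd_aboveI2)
  fix l assume l: "l \<in> {l. distinct l \<and> set l \<subseteq> \<Gamma>}"
  have "\<bar>wsum (\<lambda>\<alpha>. (c \<alpha> z)\<^sup>2) l\<bar> \<le> 2 * (norm z)\<^sup>2"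
  proof (rule wsum_abs_le)
    fix \<alpha> assume "\<alpha> \<in> set l"
    then show "\<bar>(c \<alpha> z)\<^sup>2\<bar> \<le> (norm z)\<^sup>2"
      using l c_le_norm[of \<alpha> z] by (auto simp: power2_le_iff_abs_le)
  qed simp
  then show "wsum (\<lambda>\<alpha>. (c \<alpha> z)\<^sup>2) l \<le> 2 * (norm z)\<^sup>2" by simp
qed

lemma wsum_le_day_square:
  "distinct l \<Longrightarrow> set l \<subseteq> \<Gamma> \<Longrightarrow> wsum (\<lambda>\<alpha>. (c \<alpha> z)\<^sup>2) l \<le> day_square \<Gamma> c z"
  unfolding day_square_def by (rule cSUP_upper[OF _ day_square_bdd_above]) simp

lemma day_square_le:
  "(\<And>l. distinct l \<Longrightarrow> set l \<subseteq> \<Gamma> \<Longrightarrow> wsum (\<lambda>\<alpha>. (c \<alpha> z)\<^sup>2) l \<le> b) \<Longrightarrow> day_square \<Gamma> c z \<le> b"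
  unfolding day_square_def by (rule cSUP_least) (auto intro: exI[of _ "[]"])

lemma day_square_nonneg: "0 \<le> day_square \<Gamma> c z"
  using wsum_le_day_square[of "[]" z] by simp

lemma day_square_le_add: "day_square \<Gamma> c z \<le> day_square \<Gamma> c y + 2 * (norm (z - y) * (norm z + norm y))"
proof (rule day_square_le)
  fix l assume l: "distinct l" "set l \<subseteq> \<Gamma>"
  have "\<bar>wsum (\<lambda>\<alpha>. (c \<alpha> z)\<^sup>2 - (c \<alpha> y)\<^sup>2) l\<bar> \<le> 2 * (norm (z - y) * (norm z + norm y))"
  proof (rule wsum_abs_le)
    fix \<alpha> assume "\<alpha> \<in> set l"
    then have \<alpha>: "\<alpha> \<in> \<Gamma>" using l by blast
    have "(c \<alpha> z)\<^sup>2 - (c \<alpha> y)\<^sup>2 = c \<alpha> (z - y) * (c \<alpha> z + c \<alpha> y)"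
      by (simp add: c_diff[OF \<alpha>] power2_eq_square algebra_simps)
    moreover have "\<bar>c \<alpha> z + c \<alpha> y\<bar> \<le> norm z + norm y"
      using c_le_norm[OF \<alpha>, of z] c_le_norm[OF \<alpha>, of y] by linarith
    ultimately show "\<bar>(c \<alpha> z)\<^sup>2 - (c \<alpha> y)\<^sup>2\<bar> \<le> norm (z - y) * (norm z + norm y)"
      using c_le_norm[OF \<alpha>, of "z - y"] by (simp add: abs_mult mult_mono)
  qed simp
  then have "wsum (\<lambda>\<alpha>. (c \<alpha> z)\<^sup>2) l \<le> wsum (\<lambda>\<alpha>. (c \<alpha> y)\<^sup>2) l + 2 * (norm (z - y) * (norm z + norm y))"
    by (simp add: wsum_diff)
  then show "wsum (\<lambda>\<alpha>. (c \<alpha> z)\<^sup>2) l \<le> day_square \<Gamma> c y + 2 * (norm (z - y) * (norm z + norm y))"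
    using wsum_le_day_square[OF l, of y] by linarith
qed

lemma continuous_day_square: "continuous_on UNIV (day_square \<Gamma> c)"
  unfolding continuous_on_def
proof (intro ballI)
  fix y :: 'a
  have "((\<lambda>z. 2 * (norm (z - y) * (norm z + norm y))) \<longlongrightarrow> 2 * (norm (y - y) * (norm y + norm y))) (at y)"
    by (intro tendsto_intros)
  then have "((\<lambda>z. 2 * (norm (z - y) * (norm z + norm y))) \<longlongrightarrow> 0) (at y)" by simp
  moreover have "norm (day_square \<Gamma> c z - day_square \<Gamma> c y) \<le> 2 * (norm (z - y) * (norm z + norm y))" for z
    using day_square_le_add[of z y] day_square_le_add[of y z]
    by (simp add: abs_le_iff norm_minus_commute add.commute)
  then have "\<forall>z. norm (day_square \<Gamma> c z - day_square \<Gamma> c y) \<le> 2 * (norm (z - y) * (norm z + norm y))" ..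
  ultimately have "((\<lambda>z. day_square \<Gamma> c z - day_square \<Gamma> c y) \<longlongrightarrow> 0) (at y)"
    by (rule Lim_null_comparison[OF always_eventually, rotated])
  then show "(day_square \<Gamma> c \<longlongrightarrow> day_square \<Gamma> c y) (at y)"
    by (simp add: LIM_zero_iff)
qed

text \<open>At a vector of finite support the supremum is attained at an enumeration of the whole
  support: entries with zero coordinate may be removed from a list without decreasing its
  weighted sum, and appending a missing support element strictly increases it.\<close>

lemma day_square_attained:
  assumes "finite {\<alpha> \<in> \<Gamma>. c \<alpha> y \<noteq> 0}"
  obtains l where "distinct l" "set l = {\<alpha> \<in> \<Gamma>. c \<alpha> y \<noteq> 0}" "day_square \<Gamma> c y = wsum (\<lambda>\<alpha>. (c \<alpha> y)\<^sup>2) l"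
proof -
  define G where "G = {\<alpha> \<in> \<Gamma>. c \<alpha> y \<noteq> 0}"
  define w where "w = wsum (\<lambda>\<alpha>. (c \<alpha> y)\<^sup>2)"
  define D where "D = {l. set l \<subseteq> G \<and> distinct l}"
  have "finite D" "D \<noteq> {}"
    using assms by (auto simp: D_def G_def intro!: finite_subset_distinct exI[of _ "[]"])
  then have "Max (w ` D) \<in> w ` D" by (intro Max_in) auto
  then obtain l where l: "l \<in> D" "w l = Max (w ` D)" by auto
  have max: "w l' \<le> w l" if "l' \<in> D" for l'
    unfolding l(2) using \<open>finite D\<close> that by (intro Max_ge) auto
  have "set l = G"
  proof (rule ccontr)
    assume "set l \<noteq> G"
    then obtain \<alpha> where \<alpha>: "\<alpha> \<in> G" "\<alpha> \<notin> set l" using l(1) by (auto simp: D_def)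
    then have "w (l @ [\<alpha>]) \<le> w l" using l(1) by (intro max) (auto simp: D_def)
    then have "(c \<alpha> y)\<^sup>2 / 2 ^ length l \<le> 0" by (simp add: w_def wsum_append)
    moreover have "0 < (c \<alpha> y)\<^sup>2 / 2 ^ length l" using \<alpha>(1) by (simp add: G_def)
    ultimately show False by linarith
  qed
  moreover have "day_square \<Gamma> c y \<le> w l"
  proof (rule day_square_le)
    fix l' assume l': "distinct l'" "set l' \<subseteq> \<Gamma>"
    have "wsum (\<lambda>\<alpha>. (c \<alpha> y)\<^sup>2) l' \<le> w (filter (\<lambda>\<alpha>. (c \<alpha> y)\<^sup>2 \<noteq> 0) l')"
      unfolding w_def by (rule wsum_le_filter) simp
    also have "\<dots> \<le> w l" using l' by (intro max) (auto simp: D_def G_def)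
    finally show "wsum (\<lambda>\<alpha>. (c \<alpha> y)\<^sup>2) l' \<le> w l" .
  qed
  moreover have "w l \<le> day_square \<Gamma> c y"
    unfolding w_def using l(1) by (intro wsum_le_day_square) (auto simp: D_def G_def)
  ultimately show ?thesis
    using that[of l] l(1) by (auto simp: D_def G_def w_def)
qed

text \<open>The norm makes this function coercive, the Day term makes it exposed at vectors of finite
  support. What is used of it are affine minorants that touch it at such vectors.\<close>

definition day_gauge :: "'a \<Rightarrow> real"
  where "day_gauge z = norm z + day_square \<Gamma> c z"

lemma continuous_day_gauge: "continuous_on UNIV day_gauge"
  unfolding day_gauge_def by (intro continuous_intros continuous_day_square)

text \<open>At a point \<open>g\<close> with support \<open>G\<close> the gauge has an affine minorant \<open>\<phi>\<close> touching it at \<open>g\<close> that lies well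
  below it wherever a coordinate in \<open>G\<close> moves away from its value at \<open>g\<close>. The Day term dominates the
  quadratic form \<open>q\<close> of an enumeration of \<open>G\<close>, with equality at \<open>g\<close>, and
  \<open>x\<^sup>2 - (2 b x - b\<^sup>2) = (x - b)\<^sup>2\<close> measures how far \<open>q\<close> exceeds its tangent at \<open>g\<close>; the norm
  contributes a norming functional.\<close>

lemma exposing_functional:
  assumes fin: "finite {\<alpha> \<in> \<Gamma>. c \<alpha> g \<noteq> 0}"
  obtains \<phi> where "affine_functional \<phi>" "\<phi> g = day_gauge g" "\<And>z. \<phi> z \<le> day_gauge z"
    "\<And>z \<alpha>. \<alpha> \<in> \<Gamma> \<Longrightarrow> c \<alpha> g \<noteq> 0 \<Longrightarrow>
      \<phi> z \<le> day_gauge z - (c \<alpha> z - c \<alpha> g)\<^sup>2 / 2 ^ card {\<alpha> \<in> \<Gamma>. c \<alpha> g \<noteq> 0}"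
proof -
  obtain l where l: "distinct l" "set l = {\<alpha> \<in> \<Gamma>. c \<alpha> g \<noteq> 0}"
    "day_square \<Gamma> c g = wsum (\<lambda>\<alpha>. (c \<alpha> g)\<^sup>2) l"
    using day_square_attained[OF fin] .
  obtain \<nu> :: "'a \<Rightarrow> real" where \<nu>: "bounded_linear \<nu>" "\<And>x. \<nu> x \<le> norm x" "\<nu> g = norm g"
    using norming_functional[of g] by blast
  define \<tau> where "\<tau> z = wsum (\<lambda>\<alpha>. 2 * c \<alpha> g * c \<alpha> z - (c \<alpha> g)\<^sup>2) l" for z
  have gap: "wsum (\<lambda>\<alpha>. (c \<alpha> z)\<^sup>2) l - \<tau> z = wsum (\<lambda>\<alpha>. (c \<alpha> z - c \<alpha> g)\<^sup>2) l" for z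
    unfolding \<tau>_def wsum_diff[symmetric] by (simp add: power2_eq_square algebra_simps)
  have le: "\<nu> z + \<tau> z \<le> day_gauge z - wsum (\<lambda>\<alpha>. (c \<alpha> z - c \<alpha> g)\<^sup>2) l" for z
    using \<nu>(2)[of z] wsum_le_day_square[of l z] l(1,2) gap[of z] by (simp add: day_gauge_def)
  show ?thesis
  proof (rule that[of "\<lambda>z. \<nu> z + \<tau> z"])
    have "affine_functional (\<lambda>z. 2 * c \<alpha> g * c \<alpha> z - (c \<alpha> g)\<^sup>2)" if "\<alpha> \<in> set l" for \<alpha>
      using that l(2) by (intro affine_functional_diff affine_functional_const affine_functional_linear
          bounded_linear_const_mult linear_c) auto
    then have "affine_functional \<tau>"
      unfolding \<tau>_def by (rule affine_functional_wsum)
    then show "affine_functional (\<lambda>z. \<nu> z + \<tau> z)"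
      by (rule affine_functional_add[OF affine_functional_linear[OF \<nu>(1)]])
    have "wsum (\<lambda>\<alpha>. 0) l = 0" by (induction l) auto
    then show "\<nu> g + \<tau> g = day_gauge g" using gap[of g] by (simp add: day_gauge_def \<nu>(3) l(3))
    show "\<nu> z + \<tau> z \<le> day_gauge z" for z
      using le[of z] wsum_nonneg[of "\<lambda>\<alpha>. (c \<alpha> z - c \<alpha> g)\<^sup>2" l] by simp
    fix z \<alpha> assume "\<alpha> \<in> \<Gamma>" "c \<alpha> g \<noteq> 0"
    then have "(c \<alpha> z - c \<alpha> g)\<^sup>2 / 2 ^ length l \<le> wsum (\<lambda>\<alpha>. (c \<alpha> z - c \<alpha> g)\<^sup>2) l"
      using l(2) by (intro wsum_member) auto
    then show "\<nu> z + \<tau> z \<le> day_gauge z - (c \<alpha> z - c \<alpha> g)\<^sup>2 / 2 ^ card {\<alpha> \<in> \<Gamma>. c \<alpha> g \<noteq> 0}"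
      using le[of z] distinct_card[OF l(1)] l(2) by simp
  qed
qed

section \<open>A coercive, locally finite family of affine functionals\<close>

text \<open>Raising the tangents \<open>\<phi>\<close> by a small \<open>\<epsilon>\<close> makes each exceed the gauge on an open set, and
  finitely many of these sets cover the compact set \<open>K\<close>. The bound \<open>\<delta>\<close> on the coordinates over \<open>K\<close>
  dictates \<open>\<epsilon>\<close>: a raised tangent must stay below the gauge wherever some coordinate in \<open>G\<close> is
  at most \<open>\<delta>/2\<close> in absolute value, since such a coordinate differs from that of every tangency point by at least
  \<open>\<delta>/2\<close>.\<close>

lemma finite_cover_by_slices:
  fixes \<delta> :: real
  assumes K: "compact K" and G: "finite G"
    and supp: "\<And>g. g \<in> K \<Longrightarrow> {\<alpha> \<in> \<Gamma>. c \<alpha> g \<noteq> 0} = G"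
    and \<delta>: "0 < \<delta>" "\<delta> \<le> 1" "\<And>g \<alpha>. g \<in> K \<Longrightarrow> \<alpha> \<in> G \<Longrightarrow> \<delta> \<le> \<bar>c \<alpha> g\<bar>"
  obtains H where "finite H" "\<And>h. h \<in> H \<Longrightarrow> affine_functional h"
    "\<And>y. y \<in> K \<Longrightarrow> \<exists>h\<in>H. day_gauge y < h y"
    "\<And>h z. h \<in> H \<Longrightarrow> h z \<le> day_gauge z + \<delta>"
    "\<And>h z \<alpha>. h \<in> H \<Longrightarrow> \<alpha> \<in> G \<Longrightarrow> \<bar>c \<alpha> z\<bar> \<le> \<delta> / 2 \<Longrightarrow> h z \<le> day_gauge z"
proof -
  \<comment> \<open>the least amount by which a tangent lies below the gauge once a coordinate in \<open>G\<close> moves by \<open>\<delta>/2\<close>\<close>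
  define \<epsilon> where "\<epsilon> = (\<delta> / 2)\<^sup>2 / 2 ^ card G"
  have "\<exists>\<phi>. affine_functional \<phi> \<and> \<phi> g = day_gauge g \<and> (\<forall>z. \<phi> z \<le> day_gauge z) \<and>
      (\<forall>z. \<forall>\<alpha>\<in>G. \<phi> z \<le> day_gauge z - (c \<alpha> z - c \<alpha> g)\<^sup>2 / 2 ^ card G)" if "g \<in> K" for g
  proof -
    note supp_g = supp[OF that]
    have fin: "finite {\<alpha> \<in> \<Gamma>. c \<alpha> g \<noteq> 0}" using supp_g G by simp
    obtain \<phi> where "affine_functional \<phi>" "\<phi> g = day_gauge g" "\<And>z. \<phi> z \<le> day_gauge z"
      "\<And>z \<alpha>. \<alpha> \<in> \<Gamma> \<Longrightarrow> c \<alpha> g \<noteq> 0 \<Longrightarrow> \<phi> z \<le> day_gauge z - (c \<alpha> z - c \<alpha> g)\<^sup>2 / 2 ^ card G"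
      using exposing_functional[OF fin, unfolded supp_g] by blast
    then show ?thesis using supp_g by (intro exI[of _ \<phi>]) auto
  qed
  then obtain \<phi> where \<phi>: "\<And>g. g \<in> K \<Longrightarrow> affine_functional (\<phi> g)" "\<And>g. g \<in> K \<Longrightarrow> \<phi> g g = day_gauge g"
    "\<And>g z. g \<in> K \<Longrightarrow> \<phi> g z \<le> day_gauge z"
    "\<And>g z \<alpha>. g \<in> K \<Longrightarrow> \<alpha> \<in> G \<Longrightarrow> \<phi> g z \<le> day_gauge z - (c \<alpha> z - c \<alpha> g)\<^sup>2 / 2 ^ card G"
    by metis
  have \<epsilon>: "0 < \<epsilon>" using \<delta>(1) by (simp add: \<epsilon>_def)
  have "\<epsilon> \<le> (\<delta> / 2)\<^sup>2 / 1"
    unfolding \<epsilon>_def by (rule divide_left_mono) auto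
  also have "\<dots> \<le> \<delta>"
    using \<delta>(1,2) mult_left_mono[of \<delta> 1 \<delta>] by (simp add: power2_eq_square)
  finally have \<epsilon>\<delta>: "\<epsilon> \<le> \<delta>" .
  have "open {z. day_gauge z < \<phi> g z + \<epsilon>}" if "g \<in> K" for g
    by (intro open_Collect_less continuous_day_gauge continuous_intros affine_functional_continuous \<phi>(1) that)
  moreover have "K \<subseteq> (\<Union>g\<in>K. {z. day_gauge z < \<phi> g z + \<epsilon>})"
    using \<phi>(2) \<epsilon> by auto
  ultimately obtain A where A: "A \<subseteq> K" "finite A" "K \<subseteq> (\<Union>g\<in>A. {z. day_gauge z < \<phi> g z + \<epsilon>})"
    using compactE_image[OF K, of K "\<lambda>g. {z. day_gauge z < \<phi> g z + \<epsilon>}"] by blast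
  show ?thesis
  proof (rule that[of "(\<lambda>g z. \<phi> g z + \<epsilon>) ` A"])
    show "finite ((\<lambda>g z. \<phi> g z + \<epsilon>) ` A)" using A(2) by simp
    show "affine_functional h" if "h \<in> (\<lambda>g z. \<phi> g z + \<epsilon>) ` A" for h
      using that A(1) \<phi>(1) by (auto intro!: affine_functional_add affine_functional_const)
    show "\<exists>h\<in>(\<lambda>g z. \<phi> g z + \<epsilon>) ` A. day_gauge y < h y" if "y \<in> K" for y
      using that A(3) by auto
    show "h z \<le> day_gauge z + \<delta>" if "h \<in> (\<lambda>g z. \<phi> g z + \<epsilon>) ` A" for h z
      using that A(1) \<phi>(3) \<epsilon>\<delta> by (auto intro!: add_mono)
    fix h z \<alpha> assume h: "h \<in> (\<lambda>g z. \<phi> g z + \<epsilon>) ` A" and \<alpha>: "\<alpha> \<in> G" "\<bar>c \<alpha> z\<bar> \<le> \<delta> / 2"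
    obtain g where g: "g \<in> K" "h = (\<lambda>z. \<phi> g z + \<epsilon>)" using h A(1) by auto
    have "\<delta> / 2 \<le> \<bar>c \<alpha> z - c \<alpha> g\<bar>" using \<delta>(3)[OF g(1) \<alpha>(1)] \<alpha>(2) by linarith
    then have "(\<delta> / 2)\<^sup>2 \<le> (c \<alpha> z - c \<alpha> g)\<^sup>2"
      using \<delta>(1) by (metis abs_ge_zero less_imp_le half_gt_zero power2_abs power_mono)
    then have "\<epsilon> \<le> (c \<alpha> z - c \<alpha> g)\<^sup>2 / 2 ^ card G"
      unfolding \<epsilon>_def by (rule divide_right_mono) simp
    then show "h z \<le> day_gauge z"
      using \<phi>(4)[OF g(1) \<alpha>(1), of z] by (simp add: g(2))
  qed
qed

text \<open>Collect the raised tangents of all pairs \<open>(G, n)\<close>. At \<open>y\<close> with support \<open>G\<^sub>0\<close> some member exceeds the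
  gauge by a positive margin, and this persists nearby with margin \<open>\<eta>\<close>. Members of large index
  \<open>n\<close> exceed the gauge by at most \<open>1/(n+1) < \<eta>\<close> and cannot compete. A member of small index with \<open>G\<close> not
  contained in \<open>G\<^sub>0\<close> has some \<open>\<alpha> \<in> G\<close> at which \<open>y\<close>, and hence every nearby point, has a small
  coordinate, so it does not exceed the gauge nearby. Only subsets \<open>G\<close> of \<open>G\<^sub>0\<close> and finitely many \<open>n\<close>
  remain. That the radius is uniform over the infinitely many \<open>G\<close> rests on the coordinates being
  nonexpansive.\<close>

lemma locally_finite_affine_family:
  fixes K :: "'i set \<Rightarrow> nat \<Rightarrow> 'a set"
  assumes compact_K: "\<And>G n. finite G \<Longrightarrow> G \<subseteq> \<Gamma> \<Longrightarrow> compact (K G n)"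
    and supp: "\<And>G n g. finite G \<Longrightarrow> G \<subseteq> \<Gamma> \<Longrightarrow> g \<in> K G n \<Longrightarrow> {\<alpha> \<in> \<Gamma>. c \<alpha> g \<noteq> 0} = G"
    and large: "\<And>G n g \<alpha>. finite G \<Longrightarrow> G \<subseteq> \<Gamma> \<Longrightarrow> g \<in> K G n \<Longrightarrow> \<alpha> \<in> G \<Longrightarrow> 1 / real (Suc n) \<le> \<bar>c \<alpha> g\<bar>"
    and exhaust: "\<And>y. y \<in> Y \<Longrightarrow> \<exists>G n. finite G \<and> G \<subseteq> \<Gamma> \<and> y \<in> K G n"
  obtains H where "\<And>h. h \<in> H \<Longrightarrow> affine_functional h"
    "\<And>y. y \<in> Y \<Longrightarrow> \<exists>h\<in>H. norm y \<le> h y"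
    "locally_finite_max Y H"
proof -
  define I where "I = {G. finite G \<and> G \<subseteq> \<Gamma>}"
  define slices where "slices G n S \<longleftrightarrow> finite S \<and> (\<forall>h\<in>S. affine_functional h) \<and>
      (\<forall>y\<in>K G n. \<exists>h\<in>S. day_gauge y < h y) \<and> (\<forall>h\<in>S. \<forall>z. h z \<le> day_gauge z + 1 / real (Suc n)) \<and>
      (\<forall>h\<in>S. \<forall>z. \<forall>\<alpha>\<in>G. \<bar>c \<alpha> z\<bar> \<le> 1 / real (Suc n) / 2 \<longrightarrow> h z \<le> day_gauge z)" for G n S
  have "\<exists>S. slices G n S" if "G \<in> I" for G n
  proof -
    have G: "finite G" "G \<subseteq> \<Gamma>" using that by (auto simp: I_def)
    have \<delta>: "0 < 1 / real (Suc n)" "1 / real (Suc n) \<le> 1" by simp_all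
    show ?thesis
    proof (rule finite_cover_by_slices[OF compact_K[OF G] G(1) supp[OF G] \<delta> large[OF G]])
      fix S assume "finite S" "\<And>h. h \<in> S \<Longrightarrow> affine_functional h"
        "\<And>y. y \<in> K G n \<Longrightarrow> \<exists>h\<in>S. day_gauge y < h y" "\<And>h z. h \<in> S \<Longrightarrow> h z \<le> day_gauge z + 1 / real (Suc n)"
        "\<And>h z \<alpha>. h \<in> S \<Longrightarrow> \<alpha> \<in> G \<Longrightarrow> \<bar>c \<alpha> z\<bar> \<le> 1 / real (Suc n) / 2 \<Longrightarrow> h z \<le> day_gauge z"
      then show "\<exists>S. slices G n S" unfolding slices_def by (intro exI[of _ S] conjI ballI allI impI)
    qed
  qed
  then have slices: "slices G n (SOME S. slices G n S)" if "G \<in> I" for G n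
    using that by (blast intro: someI_ex)
  define S where "S G n = (SOME S. slices G n S)" for G n
  have S: "\<And>G n. G \<in> I \<Longrightarrow> finite (S G n)"
    "\<And>G n h. G \<in> I \<Longrightarrow> h \<in> S G n \<Longrightarrow> affine_functional h"
    "\<And>G n y. G \<in> I \<Longrightarrow> y \<in> K G n \<Longrightarrow> \<exists>h\<in>S G n. day_gauge y < h y"
    "\<And>G n h z. G \<in> I \<Longrightarrow> h \<in> S G n \<Longrightarrow> h z \<le> day_gauge z + 1 / real (Suc n)"
    using slices[folded S_def, unfolded slices_def] by (auto simp del: of_nat_Suc)
  have S_small: "h z \<le> day_gauge z"
    if "G \<in> I" "h \<in> S G n" "\<alpha> \<in> G" "\<bar>c \<alpha> z\<bar> \<le> 1 / real (Suc n) / 2" for G n h z \<alpha>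
    using slices[OF that(1), of n, folded S_def, unfolded slices_def] that(2-) by blast
  define H where "H = (\<Union>G\<in>I. \<Union>n. S G n)"
  have above: "\<exists>h\<in>H. day_gauge y < h y" if y: "y \<in> Y" for y
  proof -
    obtain G n where "G \<in> I" "y \<in> K G n" using exhaust[OF y] by (auto simp: I_def)
    then show ?thesis using S(3)[of G y n] by (auto simp: H_def)
  qed
  show ?thesis
  proof (rule that[of H])
    show "affine_functional h" if "h \<in> H" for h
      using that S(2) by (auto simp: H_def)
    show "\<exists>h\<in>H. norm y \<le> h y" if "y \<in> Y" for y
    proof -
      obtain h where "h \<in> H" "day_gauge y < h y" using above[OF \<open>y \<in> Y\<close>] by blast
      moreover have "norm y \<le> day_gauge y" using day_square_nonneg[of y] by (simp add: day_gauge_def)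
      ultimately show ?thesis by (intro bexI[of _ h]) linarith+
    qed
    show "locally_finite_max Y H"
      unfolding locally_finite_max_def
    proof
      fix y assume y: "y \<in> Y"
      obtain G0 n0 where G0: "finite G0" "G0 \<subseteq> \<Gamma>" "y \<in> K G0 n0" using exhaust[OF y] by blast
      obtain h0 where h0: "h0 \<in> H" "day_gauge y < h0 y" using above[OF y] by blast
      define \<eta> where "\<eta> = (h0 y - day_gauge y) / 2"
      have \<eta>: "0 < \<eta>" using h0 by (simp add: \<eta>_def)
      obtain k where k: "1 / real (Suc k) < \<eta>"
        using reals_Archimedean[OF \<eta>] by (auto simp: inverse_eq_divide)
      define U where "U = {z. day_gauge z + \<eta> < h0 z} \<inter> ball y (1 / real (Suc k) / 2)"
      define F where "F = insert h0 (\<Union>G\<in>Pow G0. \<Union>n\<in>{..k}. S G n)"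
      have PowI: "Pow G0 \<subseteq> I" using G0 by (auto simp: I_def intro: finite_subset)
      have "affine_functional h0" using h0(1) S(2) by (auto simp: H_def)
      then have "open {z. day_gauge z + \<eta> < h0 z}"
        by (intro open_Collect_less continuous_day_gauge continuous_intros affine_functional_continuous)
      then have "open U" by (auto simp: U_def)
      moreover have "y \<in> U" using \<eta> by (simp add: U_def \<eta>_def field_simps)
      moreover have "finite F" using S(1) PowI G0(1) by (auto simp: F_def)
      moreover have "F \<subseteq> H" using h0(1) PowI by (auto simp: F_def H_def)
      moreover have "h0 \<in> F" by (simp add: F_def)
      moreover have "h' z < h0 z" if z: "z \<in> U" and h': "h' \<in> H - F" for z h'
      proof -
        obtain G n where G: "G \<in> I" "h' \<in> S G n" "\<not> (G \<subseteq> G0 \<and> n \<le> k)"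
        proof -
          obtain G n where "G \<in> I" "h' \<in> S G n" using h' by (auto simp: H_def)
          moreover have "\<not> (G \<subseteq> G0 \<and> n \<le> k)" if "h' \<in> S G n" for G n
            using h' that by (auto simp: F_def)
          ultimately show ?thesis using that by blast
        qed
        have z0: "day_gauge z + \<eta> < h0 z" "norm (z - y) < 1 / real (Suc k) / 2"
          using z by (auto simp: U_def dist_norm norm_minus_commute)
        show ?thesis
        proof (cases "n \<le> k")
          case False
          then have "1 / real (Suc n) \<le> 1 / real (Suc k)" by (intro divide_left_mono) auto
          then show ?thesis using S(4)[OF G(1,2), of z] k z0(1) by linarith
        next
          case True
          then obtain \<alpha> where \<alpha>: "\<alpha> \<in> G" "\<alpha> \<notin> G0" using G(3) by blast
          then have "\<alpha> \<in> \<Gamma>" using G(1) by (auto simp: I_def)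
          then have "c \<alpha> y = 0" using supp[OF G0] \<alpha>(2) by blast
          then have "\<bar>c \<alpha> z\<bar> \<le> norm (z - y)"
            using c_le_norm[OF \<open>\<alpha> \<in> \<Gamma>\<close>, of "z - y"] c_diff[OF \<open>\<alpha> \<in> \<Gamma>\<close>, of z y] by simp
          also have "\<dots> \<le> 1 / real (Suc k) / 2" using z0(2) by simp
          also have "\<dots> \<le> 1 / real (Suc n) / 2"
            using True by (intro divide_right_mono divide_left_mono) auto
          finally have "h' z \<le> day_gauge z" by (rule S_small[OF G(1,2) \<alpha>(1)])
          then show ?thesis using z0(1) \<eta> by linarith
        qed
      qed
      ultimately show "\<exists>U F. open U \<and> y \<in> U \<and> finite F \<and> F \<subseteq> H \<and>
             (\<forall>z\<in>U \<inter> Y. \<exists>h\<in>F. \<forall>h'\<in>H - F. h' z < h z)"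
        by (intro exI[of _ U] exI[of _ F]) blast
    qed
  qed
qed

end

section \<open>Spans of biorthogonal systems\<close>

lemma compact_box_span:
  fixes e :: "'i \<Rightarrow> 'a::real_normed_vector"
  assumes "finite G"
  shows "compact {\<Sum>\<alpha>\<in>G. t \<alpha> *\<^sub>R e \<alpha> | t. \<forall>\<alpha>\<in>G. \<bar>t \<alpha>\<bar> \<le> r}"
  using assms
proof (induction G rule: finite_induct)
  case (insert \<beta> G)
  let ?B = "\<lambda>G. {\<Sum>\<alpha>\<in>G. t \<alpha> *\<^sub>R e \<alpha> | t. \<forall>\<alpha>\<in>G. \<bar>t \<alpha>\<bar> \<le> r}"
  have "compact ((\<lambda>s. s *\<^sub>R e \<beta>) ` {-r..r})"
    by (intro compact_continuous_image continuous_intros compact_Icc)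
  then have "compact {x + y | x y. x \<in> (\<lambda>s. s *\<^sub>R e \<beta>) ` {-r..r} \<and> y \<in> ?B G}"
    using insert.IH by (rule compact_sums)
  also have "{x + y | x y. x \<in> (\<lambda>s. s *\<^sub>R e \<beta>) ` {-r..r} \<and> y \<in> ?B G} = ?B (insert \<beta> G)"
  proof (intro antisym subsetI)
    fix v assume "v \<in> {x + y | x y. x \<in> (\<lambda>s. s *\<^sub>R e \<beta>) ` {-r..r} \<and> y \<in> ?B G}"
    then obtain s t where st: "s \<in> {-r..r}" "\<forall>\<alpha>\<in>G. \<bar>t \<alpha>\<bar> \<le> r"
      "v = s *\<^sub>R e \<beta> + (\<Sum>\<alpha>\<in>G. t \<alpha> *\<^sub>R e \<alpha>)" by blast
    have "(\<Sum>\<alpha>\<in>G. (t(\<beta> := s)) \<alpha> *\<^sub>R e \<alpha>) = (\<Sum>\<alpha>\<in>G. t \<alpha> *\<^sub>R e \<alpha>)"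
      using insert.hyps(2) by (intro sum.cong) auto
    then have "v = (\<Sum>\<alpha>\<in>insert \<beta> G. (t(\<beta> := s)) \<alpha> *\<^sub>R e \<alpha>)"
      using st(3) insert.hyps by simp
    moreover have "\<forall>\<alpha>\<in>insert \<beta> G. \<bar>(t(\<beta> := s)) \<alpha>\<bar> \<le> r"
      using st(1,2) by auto
    ultimately show "v \<in> ?B (insert \<beta> G)" by blast
  next
    fix v assume "v \<in> ?B (insert \<beta> G)"
    then obtain t where t: "v = (\<Sum>\<alpha>\<in>insert \<beta> G. t \<alpha> *\<^sub>R e \<alpha>)" "\<forall>\<alpha>\<in>insert \<beta> G. \<bar>t \<alpha>\<bar> \<le> r" by blast
    then have "v = t \<beta> *\<^sub>R e \<beta> + (\<Sum>\<alpha>\<in>G. t \<alpha> *\<^sub>R e \<alpha>)" "t \<beta> \<in> {-r..r}"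
      using insert.hyps by auto
    with t(2) show "v \<in> {x + y | x y. x \<in> (\<lambda>s. s *\<^sub>R e \<beta>) ` {-r..r} \<and> y \<in> ?B G}" by blast
  qed
  finally show ?case .
qed simp

text \<open>The expansion is claimed for all sufficiently large finite index sets rather than for the
  support, so that the property is visibly closed under sums.\<close>

lemma biorthogonal_finite_expansion:
  assumes bio: "biorthogonal_system \<Gamma> e e'" and y: "y \<in> span (e ` \<Gamma>)"
  shows "\<exists>G. finite G \<and> G \<subseteq> \<Gamma> \<and> (\<forall>F. finite F \<longrightarrow> G \<subseteq> F \<longrightarrow> F \<subseteq> \<Gamma> \<longrightarrow>
    y = (\<Sum>\<alpha>\<in>F. blinfun_apply (e' \<alpha>) y *\<^sub>R e \<alpha>))" (is "?P y")
  using y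
proof (induction rule: span_induct)
  case (step v)
  then obtain \<beta> where \<beta>: "\<beta> \<in> \<Gamma>" "v = e \<beta>" by blast
  have "v = (\<Sum>\<alpha>\<in>F. blinfun_apply (e' \<alpha>) v *\<^sub>R e \<alpha>)" if F: "finite F" "{\<beta>} \<subseteq> F" "F \<subseteq> \<Gamma>" for F
  proof -
    have "(\<Sum>\<alpha>\<in>F. blinfun_apply (e' \<alpha>) v *\<^sub>R e \<alpha>) = (\<Sum>\<alpha>\<in>F. if \<alpha> = \<beta> then e \<alpha> else 0)"
      using bio \<beta> F(3) by (intro sum.cong) (auto simp: biorthogonal_system_def)
    then show ?thesis using F \<beta> by (simp add: sum.delta)
  qed
  then show ?case using \<beta>(1) by (intro exI[of _ "{\<beta>}"]) auto
next
  case base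
  show ?case
  proof (rule subspaceI)
    show "0 \<in> {y. ?P y}" by (auto simp: blinfun.zero_right)
  next
    fix x y assume "x \<in> {y. ?P y}" "y \<in> {y. ?P y}"
    then obtain G G' where
      G: "finite G" "G \<subseteq> \<Gamma>" "\<And>F. finite F \<Longrightarrow> G \<subseteq> F \<Longrightarrow> F \<subseteq> \<Gamma> \<Longrightarrow> x = (\<Sum>\<alpha>\<in>F. blinfun_apply (e' \<alpha>) x *\<^sub>R e \<alpha>)" and
      G': "finite G'" "G' \<subseteq> \<Gamma>" "\<And>F. finite F \<Longrightarrow> G' \<subseteq> F \<Longrightarrow> F \<subseteq> \<Gamma> \<Longrightarrow> y = (\<Sum>\<alpha>\<in>F. blinfun_apply (e' \<alpha>) y *\<^sub>R e \<alpha>)"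
      by blast
    have "x + y = (\<Sum>\<alpha>\<in>F. blinfun_apply (e' \<alpha>) (x + y) *\<^sub>R e \<alpha>)"
      if "finite F" "G \<union> G' \<subseteq> F" "F \<subseteq> \<Gamma>" for F
      using G(3)[of F] G'(3)[of F] that by (simp add: blinfun.add_right scaleR_add_left sum.distrib)
    then show "x + y \<in> {y. ?P y}"
      using G G' by (intro CollectI exI[of _ "G \<union> G'"]) auto
  next
    fix r x assume "x \<in> {y. ?P y}"
    then obtain G where
      G: "finite G" "G \<subseteq> \<Gamma>" "\<And>F. finite F \<Longrightarrow> G \<subseteq> F \<Longrightarrow> F \<subseteq> \<Gamma> \<Longrightarrow> x = (\<Sum>\<alpha>\<in>F. blinfun_apply (e' \<alpha>) x *\<^sub>R e \<alpha>)"
      by blast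
    have "r *\<^sub>R x = (\<Sum>\<alpha>\<in>F. blinfun_apply (e' \<alpha>) (r *\<^sub>R x) *\<^sub>R e \<alpha>)"
      if "finite F" "G \<subseteq> F" "F \<subseteq> \<Gamma>" for F
    proof -
      have "(\<Sum>\<alpha>\<in>F. blinfun_apply (e' \<alpha>) (r *\<^sub>R x) *\<^sub>R e \<alpha>) = r *\<^sub>R (\<Sum>\<alpha>\<in>F. blinfun_apply (e' \<alpha>) x *\<^sub>R e \<alpha>)"
        by (simp add: blinfun.scaleR_right scaleR_sum_right)
      then show ?thesis using G(3)[OF that] by simp
    qed
    then show "r *\<^sub>R x \<in> {y. ?P y}"
      using G by (intro CollectI exI[of _ G]) auto
  qed
qed

lemma biorthogonal_coordinate_of_sum:
  assumes "biorthogonal_system \<Gamma> e e'" "finite G" "G \<subseteq> \<Gamma>" "\<beta> \<in> \<Gamma>"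
  shows "blinfun_apply (e' \<beta>) (\<Sum>\<alpha>\<in>G. t \<alpha> *\<^sub>R e \<alpha>) = (if \<beta> \<in> G then t \<beta> else 0)"
proof -
  have "blinfun_apply (e' \<beta>) (\<Sum>\<alpha>\<in>G. t \<alpha> *\<^sub>R e \<alpha>) = (\<Sum>\<alpha>\<in>G. if \<beta> = \<alpha> then t \<alpha> else 0)"
    unfolding blinfun.sum_right using assms
    by (intro sum.cong) (auto simp: biorthogonal_system_def blinfun.scaleR_right subset_iff)
  then show ?thesis using assms(2) by simp
qed

theorem corollary4p10:
  fixes \<Gamma> :: "'i set"
    and e :: "'i \<Rightarrow> 'a::real_normed_vector"
    and e' :: "'i \<Rightarrow> 'a \<Rightarrow>\<^sub>L real"
    and Y :: "'a set"
  assumes "biorthogonal_system \<Gamma> e e'"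
    and "Y = span (e ` \<Gamma>)"
  shows "\<exists>\<T>. tiling_of Y \<T> \<and> locally_finite_in (top_of_set Y) \<T> \<and> (\<forall>C\<in>\<T>. bounded C)"
proof -
  note coord = biorthogonal_coordinate_of_sum[OF assms(1)]
  \<comment> \<open>the normalisation makes all coordinates nonexpansive, whatever the norms of the functionals\<close>
  define c where "c \<alpha> y = blinfun_apply (e' \<alpha>) y / norm (e' \<alpha>)" for \<alpha> y
  have pos: "norm (e' \<alpha>) > 0" if "\<alpha> \<in> \<Gamma>" for \<alpha>
  proof -
    have "blinfun_apply (e' \<alpha>) (e \<alpha>) = 1" using assms(1) that by (auto simp: biorthogonal_system_def)
    then have "e' \<alpha> \<noteq> 0" by auto
    then show ?thesis by simp
  qed
  have linear_c: "bounded_linear (c \<alpha>)" for \<alpha>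
    unfolding c_def by (intro bounded_linear_divide[THEN bounded_linear_compose] blinfun.bounded_linear_right)
  have c_le: "\<bar>c \<alpha> y\<bar> \<le> norm y" if "\<alpha> \<in> \<Gamma>" for \<alpha> y
    using norm_blinfun[of "e' \<alpha>" y] pos[OF that] by (simp add: c_def field_simps abs_mult)
  \<comment> \<open>the coefficient bound gives compactness, the lower bound keeps away from smaller supports\<close>
  define K where "K G n = {\<Sum>\<alpha>\<in>G. t \<alpha> *\<^sub>R e \<alpha> | t. \<forall>\<alpha>\<in>G. \<bar>t \<alpha>\<bar> \<le> real n} \<inter>
      (\<Inter>\<alpha>\<in>G. {y. 1 / real (Suc n) \<le> \<bar>c \<alpha> y\<bar>})" for G n
  have compact_K: "compact (K G n)" if "finite G" for G n
    unfolding K_def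
    by (intro compact_Int_closed compact_box_span that closed_INT ballI closed_Collect_le
        continuous_intros linear_continuous_on linear_c)
  have supp_K: "{\<alpha> \<in> \<Gamma>. c \<alpha> g \<noteq> 0} = G" if G: "finite G" "G \<subseteq> \<Gamma>" "g \<in> K G n" for G n g
  proof -
    obtain t where t: "g = (\<Sum>\<alpha>\<in>G. t \<alpha> *\<^sub>R e \<alpha>)" using G(3) by (auto simp: K_def)
    have "c \<alpha> g = 0" if "\<alpha> \<in> \<Gamma>" "\<alpha> \<notin> G" for \<alpha>
      using coord[OF G(1,2) that(1), of t] that(2) by (simp add: c_def t)
    moreover have "c \<alpha> g \<noteq> 0" if "\<alpha> \<in> G" for \<alpha>
    proof
      assume "c \<alpha> g = 0"
      then have "1 / real (Suc n) \<le> 0" using G(3) that by (auto simp: K_def simp del: of_nat_Suc)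
      then show False by (simp del: of_nat_Suc)
    qed
    ultimately show ?thesis using G(2) by blast
  qed
  have exhaust: "\<exists>G n. finite G \<and> G \<subseteq> \<Gamma> \<and> y \<in> K G n" if "y \<in> Y" for y
  proof -
    have "y \<in> span (e ` \<Gamma>)" using that assms(2) by simp
    then obtain F where F: "finite F" "F \<subseteq> \<Gamma>" "y = (\<Sum>\<alpha>\<in>F. blinfun_apply (e' \<alpha>) y *\<^sub>R e \<alpha>)"
      using biorthogonal_finite_expansion[OF assms(1)] by (meson order_refl)
    define G where "G = {\<alpha> \<in> F. c \<alpha> y \<noteq> 0}"
    have G: "finite G" "G \<subseteq> \<Gamma>" using F by (auto simp: G_def)
    have "(\<Sum>\<alpha>\<in>F. blinfun_apply (e' \<alpha>) y *\<^sub>R e \<alpha>) = (\<Sum>\<alpha>\<in>G. blinfun_apply (e' \<alpha>) y *\<^sub>R e \<alpha>)"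
      using F(1) by (rule sum.mono_neutral_right) (use F(2) pos in \<open>auto simp: G_def c_def\<close>)
    with F(3) have "y = (\<Sum>\<alpha>\<in>G. blinfun_apply (e' \<alpha>) y *\<^sub>R e \<alpha>)" by (rule trans)
    moreover obtain n where n: "\<forall>\<alpha>\<in>G. \<bar>blinfun_apply (e' \<alpha>) y\<bar> \<le> real n \<and> 1 / real (Suc n) \<le> \<bar>c \<alpha> y\<bar>"
    proof -
      have "eventually (\<lambda>n. \<bar>blinfun_apply (e' \<alpha>) y\<bar> \<le> real n \<and> 1 / real (Suc n) \<le> \<bar>c \<alpha> y\<bar>) sequentially"
        if "\<alpha> \<in> G" for \<alpha>
      proof (rule eventually_conj)
        show "eventually (\<lambda>n. \<bar>blinfun_apply (e' \<alpha>) y\<bar> \<le> real n) sequentially"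
          using filterlim_real_sequentially by (auto simp: filterlim_at_top)
        have "0 < \<bar>c \<alpha> y\<bar>" using that by (simp add: G_def)
        then have "eventually (\<lambda>n. 1 / real (Suc n) < \<bar>c \<alpha> y\<bar>) sequentially"
          using LIMSEQ_inverse_real_of_nat
          by (intro order_tendstoD(2)[of _ 0]) (simp_all add: inverse_eq_divide)
        then show "eventually (\<lambda>n. 1 / real (Suc n) \<le> \<bar>c \<alpha> y\<bar>) sequentially"
          by eventually_elim simp
      qed
      then have "eventually (\<lambda>n. \<forall>\<alpha>\<in>G. \<bar>blinfun_apply (e' \<alpha>) y\<bar> \<le> real n \<and> 1 / real (Suc n) \<le> \<bar>c \<alpha> y\<bar>)
          sequentially"
        using G(1) by (intro eventually_ball_finite) auto
      then have "\<exists>n. \<forall>\<alpha>\<in>G. \<bar>blinfun_apply (e' \<alpha>) y\<bar> \<le> real n \<and> 1 / real (Suc n) \<le> \<bar>c \<alpha> y\<bar>"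
        by (rule eventually_happens'[OF sequentially_bot])
      then show ?thesis by (elim exE) (rule that)
    qed
    ultimately have "y \<in> K G n"
      unfolding K_def by (intro IntI CollectI exI[of _ "\<lambda>\<alpha>. blinfun_apply (e' \<alpha>) y"]) auto
    then show ?thesis using G by blast
  qed
  have "convex Y" unfolding assms(2) by (intro subspace_imp_convex subspace_span)
  show ?thesis
  proof (rule locally_finite_affine_family[of \<Gamma> c K Y])
    show "bounded_linear (c \<alpha>)" for \<alpha>
      by (rule linear_c)
    show "\<bar>c \<alpha> z\<bar> \<le> norm z" if "\<alpha> \<in> \<Gamma>" for \<alpha> z
      using that by (rule c_le)
    show "compact (K G n)" if "finite G" for G n
      using that by (rule compact_K)
    show "{\<alpha> \<in> \<Gamma>. c \<alpha> g \<noteq> 0} = G" if "finite G" "G \<subseteq> \<Gamma>" "g \<in> K G n" for G n g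
      using that by (rule supp_K)
    show "1 / real (Suc n) \<le> \<bar>c \<alpha> g\<bar>" if "g \<in> K G n" "\<alpha> \<in> G" for G n g \<alpha>
      using that by (simp add: K_def)
    show "\<exists>G n. finite G \<and> G \<subseteq> \<Gamma> \<and> y \<in> K G n" if "y \<in> Y" for y
      using that by (rule exhaust)
    fix H assume "\<And>h. h \<in> H \<Longrightarrow> affine_functional h"
      "\<And>y. y \<in> Y \<Longrightarrow> \<exists>h\<in>H. norm y \<le> h y" "locally_finite_max Y H"
    then show ?thesis by (rule tiling_from_affine_maximum[OF \<open>convex Y\<close>])
  qed
qed

end
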